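(* Let $F=Z^n+\sum_{k=0}^{n-2}a_k(X,Y)Z^k$ be a WT equation with $\overline F=Z^n$ and let $\alpha\in K$. Assume $\overline{a_k}(1,\alpha)\neq0$ for all $k=0,\dots,n-2$, where $\overline{a_k}$ is the initial form of $a_k$. If $F^{(1)}$ is the equation of the quadratic transform in the direction $(1:\alpha:0)$ and the multiplicity has not dropped, then $\Delta(F^{(1)})$ is a GWT quadrant.
   Context: $K$ is an algebraically closed field of characteristic $0$ and $\nu$ is the usual order function on power series; $\overline F$ denotes the initial (lowest degree homogeneous) form of $F$. A Weierstrass-Tchirnhausen (WT) equation (of multiplicity $n>1$) is $F=Z^n+\sum_{k=0}^{n-2}a_k(X,Y)Z^k$ with $a_k=\sum_{i,j} a_{ijk}X^iY^j\in K[[X,Y]]$, $\nu(a_k)\ge n-k$. It is a Generalized Weierstrass-Tchirnhausen (GWT) equation if moreover every $a_k$ is regular in $X$ of order $\nu_k=\nu(a_k)$ (i.e. $X^{\nu_k}$ appears in $a_k$ with non-zero coefficient). The Hironaka polygon $\Delta(F)$ is the convex hull of $\bigcup_{a_{ijk}\ne0}\left[\left(\frac{i}{n-k},\frac{j}{n-k}\right)+\mathbb Q_{\ge0}^2\right]$ (over the monomials other than $Z^n$). It is a quadrant if it has only one vertex. It is a GWT quadrant if it is a quadrant and the equation defining it is a GWT equation (so the vertex lies on the $OX$-axis). The quadratic transformation in the direction $(1:\alpha:0)$ is $X\mapsto X$, $Y\mapsto X(Y+\alpha)$, $Z\mapsto XZ$, and $F^{(1)}$ is the image of $F$ divided by $X^n$.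 The multiplicity has not dropped means $\nu(F^{(1)})=n$. *)

theory Defs
  imports
    "HOL-Analysis.Analysis"
    "HOL-Library.Extended_Nat"
    "HOL-Computational_Algebra.Computational_Algebra"
begin

(* K[[X,Y]] is 'a fps fps with X the outer and Y the inner variable, so that a $ i $ j is the
   coefficient of X^i Y^j; likewise K[X,Y] is 'a poly poly with X outer and Y inner.
   Elements of K[[X,Y]][Z] are polynomials in Z over 'a fps fps. *)

definition ord_XY :: "'a::zero fps fps \<Rightarrow> enat" where
  "ord_XY a = Inf {enat (i + j) | i j. a $ i $ j \<noteq> 0}"

definition ord_XYZ :: "'a::zero fps fps poly \<Rightarrow> enat" where
  "ord_XYZ F = Inf {enat (i + j + k) | i j k. coeff F k $ i $ j \<noteq> 0}"

definition hom_part_XY :: "nat \<Rightarrow> 'a::comm_monoid_add fps fps \<Rightarrow> 'a poly poly" where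
  "hom_part_XY d a = (\<Sum>i\<le>d. monom (monom (a $ i $ (d - i)) (d - i)) i)"

definition hom_part_XYZ :: "nat \<Rightarrow> 'a::comm_monoid_add fps fps poly \<Rightarrow> 'a poly poly poly" where
  "hom_part_XYZ d F = (\<Sum>k\<le>d. monom (hom_part_XY (d - k) (coeff F k)) k)"

(* The initial form of 0 is 0. *)
definition initial_form_XY :: "'a::comm_monoid_add fps fps \<Rightarrow> 'a poly poly" where
  "initial_form_XY a = (case ord_XY a of enat d \<Rightarrow> hom_part_XY d a | \<infinity> \<Rightarrow> 0)"

definition initial_form_XYZ :: "'a::comm_monoid_add fps fps poly \<Rightarrow> 'a poly poly poly" where
  "initial_form_XYZ F = (case ord_XYZ F of enat d \<Rightarrow> hom_part_XYZ d F | \<infinity> \<Rightarrow> 0)"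

definition eval_XY :: "'a::comm_semiring_1 poly poly \<Rightarrow> 'a \<Rightarrow> 'a \<Rightarrow> 'a" where
  "eval_XY P x y = poly (poly P [:x:]) y"

definition WT_equation :: "nat \<Rightarrow> 'a::field fps fps poly \<Rightarrow> bool" where
  "WT_equation n F \<longleftrightarrow>
     n > 1 \<and> degree F = n \<and> coeff F n = 1 \<and> coeff F (n - 1) = 0 \<and>
     (\<forall>k\<le>n - 2. ord_XY (coeff F k) \<ge> enat (n - k))"

(* The zero series is not regular of any order. *)
definition regular_in_X :: "'a::zero fps fps \<Rightarrow> bool" where
  "regular_in_X a \<longleftrightarrow> (\<exists>d. ord_XY a = enat d \<and> a $ d $ 0 \<noteq> 0)"

definition GWT_equation :: "nat \<Rightarrow> 'a::field fps fps poly \<Rightarrow> bool" where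
  "GWT_equation n F \<longleftrightarrow> WT_equation n F \<and> (\<forall>k\<le>n - 2. regular_in_X (coeff F k))"

(* The polygon lives in the real plane.  Taking translates of the rational quadrant gives the same
   real convex hull as taking translates of the real one. *)
definition hironaka_polygon :: "nat \<Rightarrow> 'a::zero fps fps poly \<Rightarrow> (real \<times> real) set" where
  "hironaka_polygon n F = convex hull
     (\<Union>(i, j, k) \<in> {(i, j, k). k < n \<and> coeff F k $ i $ j \<noteq> 0}.
        {(real i / real (n - k) + s, real j / real (n - k) + t) | s t.
           s \<in> \<rat> \<and> t \<in> \<rat> \<and> s \<ge> 0 \<and> t \<ge> 0})"

definition is_quadrant :: "(real \<times> real) set \<Rightarrow> bool" where
  "is_quadrant D \<longleftrightarrow> (\<exists>!v. v extreme_point_of D)"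

definition has_GWT_quadrant :: "nat \<Rightarrow> 'a::field fps fps poly \<Rightarrow> bool" where
  "has_GWT_quadrant n F \<longleftrightarrow> is_quadrant (hironaka_polygon n F) \<and> GWT_equation n F"

(* The substitution X |-> X, Y |-> X (Y + alpha) on K[[X,Y]].  The monomial X^i Y^j goes to
   X^(i+j) (Y + alpha)^j, so only the finitely many monomials of total degree m contribute to the
   coefficient of X^m. *)
definition qsubst_XY :: "'a::field \<Rightarrow> 'a fps fps \<Rightarrow> 'a fps fps" where
  "qsubst_XY \<alpha> a =
     Abs_fps (\<lambda>m. \<Sum>j\<le>m. fps_const (a $ (m - j) $ j) * (fps_X + fps_const \<alpha>) ^ j)"

definition qsubst_XYZ :: "'a::field \<Rightarrow> 'a fps fps poly \<Rightarrow> 'a fps fps poly" where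
  "qsubst_XYZ \<alpha> F = pcompose (map_poly (qsubst_XY \<alpha>) F) [:0, fps_X:]"

(* fps_shift n drops the terms of X-degree below n and divides the others by X^n; there is nothing
   to drop for a WT equation, see quadratic_transform_eq below. *)
definition quadratic_transform :: "nat \<Rightarrow> 'a::field \<Rightarrow> 'a fps fps poly \<Rightarrow> 'a fps fps poly" where
  "quadratic_transform n \<alpha> F = map_poly (fps_shift n) (qsubst_XYZ \<alpha> F)"

lemma qsubst_XY_0 [simp]: "qsubst_XY \<alpha> 0 = 0"
  by (simp add: qsubst_XY_def fps_eq_iff)

lemma qsubst_XY_X: "qsubst_XY \<alpha> fps_X = fps_X"
proof (rule fps_ext)
  fix m
  have "fps_X $ (m - j) $ j = (if j = 0 \<and> m = 1 then 1 else (0::'a))" if "j \<le> m" for j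
    using that by (auto simp: fps_X_def)
  then have "qsubst_XY \<alpha> fps_X $ m =
      (\<Sum>j\<le>m. if j = 0 then (if m = 1 then 1 else 0) else 0)"
    unfolding qsubst_XY_def fps_nth_Abs_fps by (intro sum.cong) auto
  then show "qsubst_XY \<alpha> fps_X $ m = fps_X $ m"
    by (simp add: fps_X_def)
qed

lemma qsubst_XY_Y:
  "qsubst_XY \<alpha> (fps_const fps_X) = fps_X * fps_const (fps_X + fps_const \<alpha>)"
proof (rule fps_ext)
  fix m
  have "fps_const fps_X $ (m - j) $ j = (if j = 1 \<and> m = 1 then 1 else (0::'a))" if "j \<le> m" for j
    using that by (auto simp: fps_X_def)
  then have "qsubst_XY \<alpha> (fps_const fps_X) $ m =
      (\<Sum>j\<le>m. if j = 1 then (if m = 1 then fps_X + fps_const \<alpha> else 0) else 0)"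
    unfolding qsubst_XY_def fps_nth_Abs_fps by (intro sum.cong) auto
  then show "qsubst_XY \<alpha> (fps_const fps_X) $ m = (fps_X * fps_const (fps_X + fps_const \<alpha>)) $ m"
    by (auto simp: fps_X_def)
qed

lemma qsubst_XY_add: "qsubst_XY \<alpha> (a + b) = qsubst_XY \<alpha> a + qsubst_XY \<alpha> b"
  by (simp add: qsubst_XY_def fps_eq_iff sum.distrib distrib_right
      flip: fps_const_add)

lemma coeff_pcompose_linear:
  "coeff (pcompose p [:0, c:]) k = coeff p k * (c::'b::comm_semiring_1) ^ k"
proof (induction p arbitrary: k)
  case (pCons a p)
  show ?case
    by (cases k) (simp_all add: pcompose_pCons pCons.IH mult_ac)
qed simp

lemma coeff_qsubst_XYZ: "coeff (qsubst_XYZ \<alpha> F) k = qsubst_XY \<alpha> (coeff F k) * fps_X ^ k"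
  by (simp add: qsubst_XYZ_def coeff_pcompose_linear coeff_map_poly)

lemma quadratic_transform_eq:
  assumes "WT_equation n F"
  shows "smult (fps_X ^ n) (quadratic_transform n \<alpha> F) = qsubst_XYZ \<alpha> F"
proof (rule poly_eqI)
  fix k
  have low: "qsubst_XY \<alpha> (coeff F k) $ m = 0" if "m + k < n" for m
  proof -
    have "coeff F k $ (m - j) $ j = 0" if "j \<le> m" for j
    proof (cases "k \<le> n - 2")
      case True
      have "ord_XY (coeff F k) \<le> enat (m - j + j)" if "coeff F k $ (m - j) $ j \<noteq> 0"
        unfolding ord_XY_def using that by (intro Inf_lower) blast
      moreover have "enat (n - k) \<le> ord_XY (coeff F k)"
        using assms True by (simp add: WT_equation_def)
      ultimately show ?thesis
        using \<open>j \<le> m\<close> \<open>m + k < n\<close> order_trans by fastforce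
    next
      case False
      then have "k = n - 1" using \<open>m + k < n\<close> by auto
      then show ?thesis using assms by (simp add: WT_equation_def)
    qed
    then show ?thesis by (simp add: qsubst_XY_def)
  qed
  show "coeff (smult (fps_X ^ n) (quadratic_transform n \<alpha> F)) k = coeff (qsubst_XYZ \<alpha> F) k"
    by (auto simp: quadratic_transform_def coeff_map_poly coeff_qsubst_XYZ fps_eq_iff
        fps_X_power_mult_nth fps_X_power_mult_right_nth low)
qed

end

theory Submission
  imports Defs
begin

text \<open>
  Write \<open>d\<^sub>k\<close> for the order of \<open>a\<^sub>k\<close>.  The substitution \<open>Y \<mapsto> X (Y + \<alpha>)\<close> collects the part of \<open>a\<^sub>k\<close> of
  total degree \<open>m\<close> into the single \<open>X\<close>-degree \<open>m\<close>, where its constant term in \<open>Y\<close> is the value of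
  that part at \<open>(1, \<alpha>)\<close>.  So the image of \<open>a\<^sub>k\<close> is divisible by \<open>X ^ d\<^sub>k\<close>, and the condition on
  \<open>\<alpha>\<close> says exactly that the cofactor is a unit of \<open>K[[X,Y]]\<close>.  After multiplication by \<open>X ^ k\<close>
  and division by \<open>X ^ n\<close>, the coefficient of \<open>Z ^ k\<close> in the transform is \<open>X ^ e\<^sub>k\<close> times a unit,
  with \<open>e\<^sub>k = d\<^sub>k + k - n\<close>; this shape is captured by \<open>X_monomial\<close>.

  Such a series is regular in \<open>X\<close> of order \<open>e\<^sub>k\<close>, and the multiplicity assumption gives
  \<open>e\<^sub>k \<ge> n - k\<close>; hence the transform is a GWT equation.  All exponents of the coefficient of \<open>Z ^ k\<close>
  lie in \<open>(e\<^sub>k, 0) + \<nat>\<^sup>2\<close>, and \<open>(e\<^sub>k, 0)\<close> is one of them.  The points generating the polygon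
  therefore all lie in the quadrant with vertex \<open>(v, 0)\<close>, where \<open>v\<close> is the least of the
  \<open>e\<^sub>k / (n - k)\<close>, and this vertex is itself a generating point.
\<close>

section \<open>Monomials in X up to units\<close>

definition X_monomial :: "nat \<Rightarrow> 'a::zero fps fps \<Rightarrow> bool" where
  "X_monomial e a \<longleftrightarrow> (\<forall>i<e. a $ i = 0) \<and> a $ e $ 0 \<noteq> 0"

lemma ord_XY_X_monomial:
  assumes "X_monomial e a"
  shows "ord_XY a = enat e"
  unfolding ord_XY_def
proof (rule antisym)
  have "a $ e $ 0 \<noteq> 0"
    using assms by (simp add: X_monomial_def)
  then have "enat (e + 0) \<in> {enat (i + j) | i j. a $ i $ j \<noteq> 0}"
    by blast
  then show "Inf {enat (i + j) | i j. a $ i $ j \<noteq> 0} \<le> enat e"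
    by (simp add: Inf_lower)
next
  have "e \<le> i" if "a $ i $ j \<noteq> 0" for i j :: nat
    using assms that by (force simp: X_monomial_def not_less[symmetric])
  then show "enat e \<le> Inf {enat (i + j) | i j. a $ i $ j \<noteq> 0}"
    by (force intro: Inf_greatest trans_le_add1)
qed

lemma coeff_eq_0_below_ord_XY:
  fixes a :: "'a::zero fps fps" and i j :: nat
  assumes "enat (i + j) < ord_XY a"
  shows "a $ i $ j = 0"
proof (rule ccontr)
  assume "a $ i $ j \<noteq> 0"
  then have "ord_XY a \<le> enat (i + j)"
    unfolding ord_XY_def by (intro Inf_lower) blast
  with assms show False by simp
qed

lemma ord_XYZ_le_ord_XY_coeff:
  fixes F :: "'a::zero fps fps poly"
  shows "ord_XYZ F \<le> ord_XY (coeff F k) + enat k"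
proof (cases "\<exists>i j :: nat. coeff F k $ i $ j \<noteq> 0")
  case True
  let ?S = "{enat (i + j) | i j. coeff F k $ i $ j \<noteq> 0}"
  have "ord_XY (coeff F k) \<in> ?S"
    unfolding ord_XY_def using True by (elim exE) (rule wellorder_InfI, blast)
  then obtain i j :: nat where ij: "coeff F k $ i $ j \<noteq> 0" "ord_XY (coeff F k) = enat (i + j)"
    by blast
  have "enat (i + j + k) \<in> {enat (i + j + k) | i j k. coeff F k $ i $ j \<noteq> 0}"
    using ij(1) by blast
  then show ?thesis
    unfolding ord_XYZ_def ij(2) plus_enat_simps by (rule Inf_lower)
next
  case False
  then show ?thesis by (simp add: ord_XY_def top_enat_def)
qed

section \<open>Coefficients of the quadratic transform\<close>

lemma eval_hom_part_XY:
  fixes a :: "'a::comm_semiring_1 fps fps"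
  shows "eval_XY (hom_part_XY d a) 1 \<alpha> = (\<Sum>i\<le>d. a $ i $ (d - i) * \<alpha> ^ (d - i))"
  by (simp add: eval_XY_def hom_part_XY_def poly_sum poly_monom flip: one_pCons)

lemma qsubst_XY_nth_nth_0:
  fixes a :: "'a::field fps fps"
  shows "qsubst_XY \<alpha> a $ m $ 0 = eval_XY (hom_part_XY m a) 1 \<alpha>"
proof -
  have "qsubst_XY \<alpha> a $ m $ 0 = (\<Sum>j\<le>m. a $ (m - j) $ j * \<alpha> ^ j)"
    by (simp add: qsubst_XY_def fps_sum_nth fps_nth_power_0)
  also have "\<dots> = (\<Sum>i\<le>m. a $ i $ (m - i) * \<alpha> ^ (m - i))"
    by (rule sum.reindex_bij_witness[of _ "\<lambda>i. m - i" "\<lambda>i. m - i"]) auto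
  finally show ?thesis by (simp add: eval_hom_part_XY)
qed

text \<open>
  The coefficient of \<open>X ^ m\<close> in the image involves only monomials of total degree \<open>m\<close>, so nothing
  appears before the order \<open>d\<close>; the next coefficient starts with the value of the initial form,
  which the assumption makes non-zero.
\<close>
lemma X_monomial_qsubst_XY:
  fixes a :: "'a::field fps fps"
  assumes "eval_XY (initial_form_XY a) 1 \<alpha> \<noteq> 0"
  obtains d where "ord_XY a = enat d" "X_monomial d (qsubst_XY \<alpha> a)"
proof (cases "ord_XY a")
  case (enat d)
  have "qsubst_XY \<alpha> a $ m = 0" if "m < d" for m
    using that enat by (simp add: qsubst_XY_def coeff_eq_0_below_ord_XY)
  moreover have "qsubst_XY \<alpha> a $ d $ 0 \<noteq> 0"
    using assms enat by (simp add: qsubst_XY_nth_nth_0 initial_form_XY_def)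
  ultimately show ?thesis
    using enat that by (simp add: X_monomial_def)
next
  case infinity
  with assms show ?thesis by (simp add: initial_form_XY_def eval_XY_def)
qed

lemma qsubst_XY_1: "qsubst_XY \<alpha> 1 = (1 :: 'a::field fps fps)"
proof (rule fps_ext)
  fix m
  have "(1 :: 'a fps fps) $ (m - j) $ j = (if j = 0 \<and> m = 0 then 1 else 0)" if "j \<le> m" for j
    using that by auto
  then have "qsubst_XY \<alpha> 1 $ m = (\<Sum>j\<le>m. if j = 0 then (if m = 0 then 1 else 0) else 0)"
    unfolding qsubst_XY_def fps_nth_Abs_fps by (intro sum.cong) auto
  then show "qsubst_XY \<alpha> 1 $ m = 1 $ m" by simp
qed

lemma coeff_quadratic_transform:
  "coeff (quadratic_transform n \<alpha> F) k = fps_shift n (qsubst_XY \<alpha> (coeff F k) * fps_X ^ k)"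
  by (simp add: quadratic_transform_def coeff_map_poly coeff_qsubst_XYZ)

lemma X_monomial_shift:
  assumes "X_monomial d a" "n \<le> d + k"
  shows "X_monomial (d + k - n) (fps_shift n (a * fps_X ^ k))"
  using assms by (auto simp: X_monomial_def fps_X_power_mult_right_nth)

text \<open>
  The bound \<open>n - k \<le> d\<close> of a WT equation ensures that division by \<open>X ^ n\<close> loses no terms; the same
  bound for the new exponent \<open>d + k - n\<close> comes from the multiplicity not having dropped.
\<close>
lemma X_monomial_coeff_quadratic_transform:
  assumes "WT_equation n F"
    and "eval_XY (initial_form_XY (coeff F k)) 1 \<alpha> \<noteq> 0"
    and "enat n \<le> ord_XYZ (quadratic_transform n \<alpha> F)"
    and "k \<le> n - 2"
  obtains e where "n - k \<le> e" "X_monomial e (coeff (quadratic_transform n \<alpha> F) k)"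
proof -
  obtain d where d: "ord_XY (coeff F k) = enat d" "X_monomial d (qsubst_XY \<alpha> (coeff F k))"
    using X_monomial_qsubst_XY assms(2) .
  have "n - k \<le> d"
    using assms(1,4) d(1) by (force simp: WT_equation_def)
  then have mono: "X_monomial (d + k - n) (coeff (quadratic_transform n \<alpha> F) k)"
    unfolding coeff_quadratic_transform by (intro X_monomial_shift d) simp
  have "enat n \<le> enat (d + k - n) + enat k"
    using order_trans[OF assms(3) ord_XYZ_le_ord_XY_coeff, of k]
    by (simp add: ord_XY_X_monomial[OF mono])
  then have "n - k \<le> d + k - n" by simp
  with mono that show ?thesis by blast
qed

lemma WT_equation_quadratic_transform:
  assumes WT: "WT_equation n F"
    and ord: "\<And>k. k \<le> n - 2 \<Longrightarrow> enat (n - k) \<le> ord_XY (coeff (quadratic_transform n \<alpha> F) k)"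
  shows "WT_equation n (quadratic_transform n \<alpha> F)"
proof -
  have n: "coeff (quadratic_transform n \<alpha> F) n = 1"
    using WT by (simp add: coeff_quadratic_transform WT_equation_def qsubst_XY_1)
  have "coeff (quadratic_transform n \<alpha> F) k = 0" if "k > n" for k
    using WT that by (simp add: coeff_quadratic_transform WT_equation_def coeff_eq_0)
  then have "degree (quadratic_transform n \<alpha> F) = n"
    using n by (intro antisym degree_le le_degree) auto
  then show ?thesis
    using WT n ord unfolding WT_equation_def by (simp add: coeff_quadratic_transform)
qed

section \<open>Quadrants in the plane\<close>

text \<open>
  The quadrant with vertex \<open>v\<close> is the union of the squares with lower left corner \<open>v\<close> and
  rational side length, and each of them is the hull of its corners.
\<close>
lemma convex_hull_rational_quadrant:
  fixes a b :: real
  assumes sub: "S \<subseteq> {a..} \<times> {b..}"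
    and rat: "\<And>s t. s \<in> \<rat> \<Longrightarrow> t \<in> \<rat> \<Longrightarrow> 0 \<le> s \<Longrightarrow> 0 \<le> t \<Longrightarrow> (a + s, b + t) \<in> S"
  shows "convex hull S = {a..} \<times> {b..}"
proof
  show "convex hull S \<subseteq> {a..} \<times> {b..}"
    using sub by (intro hull_minimal convex_Times) auto
  show "{a..} \<times> {b..} \<subseteq> convex hull S"
  proof (rule subrelI)
    fix x y assume xy: "(x, y) \<in> {a..} \<times> {b..}"
    obtain N :: nat where N: "max (x - a) (y - b) \<le> real N"
      using real_arch_simple by blast
    have "x \<in> convex hull {a, a + real N}" "y \<in> convex hull {b, b + real N}"
      using xy N by (auto simp: closed_segment_eq_real_ivl simp flip: segment_convex_hull)
    then have "(x, y) \<in> convex hull ({a, a + real N} \<times> {b, b + real N})"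
      unfolding convex_hull_Times by (rule SigmaI)
    moreover have "{a, a + real N} \<times> {b, b + real N} \<subseteq> S"
      using rat[of 0 0] rat[of 0 "real N"] rat[of "real N" 0] rat[of "real N" "real N"] by auto
    ultimately show "(x, y) \<in> convex hull S"
      using hull_mono by blast
  qed
qed

text \<open>
  The line \<open>x + y = a + b\<close> supports the quadrant at the vertex alone, which is therefore extreme.
  A point other than the vertex is the midpoint of the vertex and of its reflection in that point,
  which again lies in the quadrant.
\<close>
lemma is_quadrant_Times_atLeast:
  fixes a b :: real
  shows "is_quadrant ({a..} \<times> {b..})"
  unfolding is_quadrant_def
proof (rule ex1I)
  show "(a, b) extreme_point_of {a..} \<times> {b..}"
    by (rule extreme_point_of_Int_supporting_hyperplane_ge[of _ "(1, 1)" "a + b"])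
       (auto intro: add_mono)
next
  fix p assume p: "p extreme_point_of {a..} \<times> {b..}"
  then have mem: "p \<in> {a..} \<times> {b..}" by (simp add: extreme_point_of_def)
  let ?q = "2 *\<^sub>R p - (a, b)"
  have "(a, b) \<in> {a..} \<times> {b..}" "?q \<in> {a..} \<times> {b..}"
    using mem by (cases p; auto)+
  then have "p \<notin> open_segment (a, b) ?q"
    using p unfolding extreme_point_of_def by metis
  moreover have "midpoint (a, b) ?q = p" by (simp add: midpoint_def)
  ultimately have "?q = (a, b)"
    by (metis midpoint_in_open_segment)
  then show "p = (a, b)" by (cases p) auto
qed

text \<open>
  Each coefficient that is monomial in \<open>X\<close> contributes a quadrant with vertex \<open>(e k / (n - k), 0)\<close>
  on the axis, and quadrants with vertices on the axis are nested: the one with the least abscissa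
  contains the others.
\<close>
lemma is_quadrant_hironaka_polygon_X_monomial:
  fixes F :: "'a::field fps fps poly"
  assumes WT: "WT_equation n F"
    and mono: "\<And>k. k \<le> n - 2 \<Longrightarrow> X_monomial (e k) (coeff F k)"
  shows "is_quadrant (hironaka_polygon n F)"
proof -
  define S where "S = (\<Union>(i, j, k) \<in> {(i, j, k). k < n \<and> coeff F k $ i $ j \<noteq> 0}.
        {(real i / real (n - k) + s, real j / real (n - k) + t) | s t.
           s \<in> \<rat> \<and> t \<in> \<rat> \<and> s \<ge> 0 \<and> t \<ge> 0})"
  define slope where "slope k = real (e k) / real (n - k)" for k
  define v where "v = Min (slope ` {..n - 2})"
  have n: "n > 1" using WT by (simp add: WT_equation_def)
  have le: "k \<le> n - 2" if "k < n" "coeff F k $ i $ j \<noteq> 0" for i j k :: nat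
  proof -
    have "coeff F (n - 1) = 0" using WT by (simp add: WT_equation_def)
    then have "k \<noteq> n - 1" using that(2) by auto
    then show ?thesis using that(1) by linarith
  qed
  have "v \<in> slope ` {..n - 2}" unfolding v_def by (intro Min_in) auto
  then obtain k where k: "k \<le> n - 2" "v = slope k" by auto
  have "convex hull S = {v..} \<times> {0..}"
  proof (rule convex_hull_rational_quadrant)
    have "v \<le> real i / real (n - l)" if "l < n" "coeff F l $ i $ j \<noteq> 0" for i j l :: nat
    proof -
      have l: "l \<le> n - 2" using le that .
      then have "v \<le> slope l" unfolding v_def by (intro Min_le) auto
      moreover have "e l \<le> i"
        using mono[OF l] that(2) by (force simp: X_monomial_def not_less[symmetric])
      ultimately show ?thesis
        unfolding slope_def by (meson divide_right_mono of_nat_0_le_iff of_nat_mono order_trans)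
    qed
    then show "S \<subseteq> {v..} \<times> {0..}"
      unfolding S_def by (fastforce intro: add_increasing2)
  next
    fix s t :: real
    assume "s \<in> \<rat>" "t \<in> \<rat>" "0 \<le> s" "0 \<le> t"
    moreover have "k < n" using k n by simp
    moreover have "coeff F k $ e k $ 0 \<noteq> 0" using mono[OF k(1)] by (simp add: X_monomial_def)
    ultimately show "(v + s, 0 + t) \<in> S"
      unfolding S_def k slope_def
      by (intro UN_I[of "(e k, 0, k)"]) auto
  qed
  then show ?thesis
    using is_quadrant_Times_atLeast[of v 0] by (simp add: hironaka_polygon_def S_def)
qed

section \<open>The transform is a GWT quadrant\<close>

theorem proposition1:
  fixes F :: "'a::{alg_closed_field, field_char_0} fps fps poly"
    and \<alpha> :: 'a and n :: nat
  assumes "WT_equation n F"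
    and "initial_form_XYZ F = monom 1 n"
    and "\<forall>k\<le>n - 2. eval_XY (initial_form_XY (coeff F k)) 1 \<alpha> \<noteq> 0"
    and "ord_XYZ (quadratic_transform n \<alpha> F) = enat n"
  shows "has_GWT_quadrant n (quadratic_transform n \<alpha> F)"
proof -
  let ?G = "quadratic_transform n \<alpha> F"
  have "\<exists>e. n - k \<le> e \<and> X_monomial e (coeff ?G k)" if "k \<le> n - 2" for k
    using X_monomial_coeff_quadratic_transform[of n F k \<alpha>] assms that by auto
  then obtain e where e: "\<And>k. k \<le> n - 2 \<Longrightarrow> n - k \<le> e k"
      "\<And>k. k \<le> n - 2 \<Longrightarrow> X_monomial (e k) (coeff ?G k)"
    by metis
  have WT: "WT_equation n ?G"
    using assms(1)
    by (rule WT_equation_quadratic_transform) (simp add: ord_XY_X_monomial[OF e(2)] e(1))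
  moreover have "regular_in_X (coeff ?G k)" if "k \<le> n - 2" for k
    using e(2)[OF that] ord_XY_X_monomial[OF e(2)[OF that]]
    by (simp add: regular_in_X_def X_monomial_def)
  ultimately show ?thesis
    using is_quadrant_hironaka_polygon_X_monomial[OF WT e(2)]
    by (simp add: has_GWT_quadrant_def GWT_equation_def)
qed

end
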